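(* Let $D_L\subset\mathbb{R}^n$ be a compact, star-shaped domain centered at an equilibrium ${\bf x}^\ast$ of $\frac{d}{dt}{\bf x}=f({\bf x})$. Define $$A({\bf z}) = Df({\bf z})^T Y + Y Df({\bf z}),\qquad L({\bf x}) = ({\bf x}-{\bf x}^\ast)^T Y ({\bf x}-{\bf x}^\ast),$$ where $Y$ is the real symmetric matrix described in the context. Assume that the matrix $A({\bf z})$ is strictly negative definite for all ${\bf z}\in D_L$. Then $L$ is a Lyapunov function on $D_L$. Moreover, ${\bf x}^\ast$ is the unique equilibrium in $D_L$.
   Context: $f:\mathbb{R}^n\to\mathbb{R}^n$ is a smooth map, $\varphi$ is the flow generated by $\frac{d}{dt}{\bf x}=f({\bf x})$, and $Df({\bf z})$ is the Jacobian matrix of $f$ at ${\bf z}$. A point ${\bf x}^\ast$ is an equilibrium if $f({\bf x}^\ast)={\bf 0}$. The matrix $Y$ is $Y=\mathrm{Re}(X^{-H}I^\ast X^{-1})$, where $X$ is a nonsingular complex $n\times n$ matrix, $X^{-H}$ is the inverse of its Hermitian transpose, and $I^\ast=\mathrm{diag}(i_1,\dots,i_n)$ with $i_k=1$ if $\mathrm{Re}(\lambda_k)<0$ and $i_k=-1$ if $\mathrm{Re}(\lambda_k)>0$, for complex numbers $\lambda_1,\dots,\lambda_n$ with nonzero real parts. (In practice $X$ and $\lambda_k$ are numerically computed approximate eigenvectors and eigenvalues of $Df({\bf x}^\ast)$; no exactness is assumed.) $Y$ is real and symmetric. A set $D$ is star-shaped centered at ${\bf x}^\ast$ if ${\bf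 x}^\ast\in D$ and ${\bf x}^\ast+s({\bf x}-{\bf x}^\ast)\in D$ for all ${\bf x}\in D$, $s\in[0,1]$. A real symmetric matrix $A$ is strictly negative definite if ${\bf v}^TA{\bf v}<0$ for all real ${\bf v}\neq{\bf 0}$. A $C^1$ function $L$ is a Lyapunov function on a set $D$ if (1) $\frac{d}{dt}L(\varphi(t,{\bf x}))|_{t=0}\le 0$ for every ${\bf x}\in D$; and (2) for ${\bf x}\in D$, $\frac{d}{dt}L(\varphi(t,{\bf x}))|_{t=0}=0$ implies that $\varphi(t,{\bf x})\equiv\bar{\bf x}\in D$ for an equilibrium $\bar{\bf x}$. *)

theory Defs
  imports "HOL-Analysis.Analysis"
begin

subsection \<open>Differentiability classes\<close>

text \<open>
  The map \<open>f\<close> is of class \<open>C\<^sup>k\<close> on the whole space: all iterated directional derivatives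
  of order at most \<open>k\<close> exist (as Frechet derivatives applied to a vector) and are continuous.
  In the successor case continuity of \<open>f\<close> itself follows from differentiability.
\<close>

fun C_k :: "nat \<Rightarrow> ('a::real_normed_vector \<Rightarrow> 'b::real_normed_vector) \<Rightarrow> bool" where
  "C_k 0 f \<longleftrightarrow> continuous_on UNIV f"
| "C_k (Suc k) f \<longleftrightarrow>
     (\<forall>x. f differentiable (at x)) \<and> (\<forall>v. C_k k (\<lambda>x. frechet_derivative f (at x) v))"

definition smooth :: "('a::real_normed_vector \<Rightarrow> 'b::real_normed_vector) \<Rightarrow> bool" where
  "smooth f \<longleftrightarrow> (\<forall>k. C_k k f)"

subsection \<open>Flows, equilibria and Lyapunov functions\<close>

definition solves_ivp ::
  "('a::real_normed_vector \<Rightarrow> 'a) \<Rightarrow> 'a \<Rightarrow> real set \<Rightarrow> (real \<Rightarrow> 'a) \<Rightarrow> bool" where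
  "solves_ivp f x J u \<longleftrightarrow>
     open J \<and> is_interval J \<and> 0 \<in> J \<and> u 0 = x \<and>
     (\<forall>t\<in>J. (u has_vector_derivative f (u t)) (at t))"

text \<open>
  The flow need not be global: trajectories of a smooth vector field may blow up in finite
  time. Hence \<open>T x\<close> is the maximal interval of existence of the trajectory through \<open>x\<close>, and
  only the values \<open>\<phi> t x\<close> with \<open>t \<in> T x\<close> are meaningful. A complete flow is the case
  \<open>T x = UNIV\<close> for all \<open>x\<close>.
\<close>

definition is_flow ::
  "('a::real_normed_vector \<Rightarrow> 'a) \<Rightarrow> ('a \<Rightarrow> real set) \<Rightarrow> (real \<Rightarrow> 'a \<Rightarrow> 'a) \<Rightarrow> bool" where
  "is_flow f T \<phi> \<longleftrightarrow>
     (\<forall>x. solves_ivp f x (T x) (\<lambda>t. \<phi> t x) \<and> (\<forall>J u. solves_ivp f x J u \<longrightarrow> J \<subseteq> T x))"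

definition equilibrium :: "('a::real_normed_vector \<Rightarrow> 'a) \<Rightarrow> 'a \<Rightarrow> bool" where
  "equilibrium f x \<longleftrightarrow> f x = 0"

text \<open>
  In the last clause, \<open>\<phi>(t, x) \<equiv> xbar\<close> is read as: the trajectory exists for all
  real times and is constant.
\<close>

definition lyapunov_function_on ::
  "('a::real_normed_vector \<Rightarrow> 'a) \<Rightarrow> ('a \<Rightarrow> real set) \<Rightarrow> (real \<Rightarrow> 'a \<Rightarrow> 'a) \<Rightarrow> 'a set \<Rightarrow>
    ('a \<Rightarrow> real) \<Rightarrow> bool" where
  "lyapunov_function_on f T \<phi> D L \<longleftrightarrow>
     C_k 1 L \<and>
     (\<forall>x\<in>D. \<exists>d\<le>0. ((\<lambda>t. L (\<phi> t x)) has_real_derivative d) (at 0)) \<and>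
     (\<forall>x\<in>D. ((\<lambda>t. L (\<phi> t x)) has_real_derivative 0) (at 0) \<longrightarrow>
        (\<exists>xbar\<in>D. equilibrium f xbar \<and> (\<forall>t. t \<in> T x \<and> \<phi> t x = xbar)))"

definition star_shaped :: "'a::real_vector \<Rightarrow> 'a set \<Rightarrow> bool" where
  "star_shaped c D \<longleftrightarrow> c \<in> D \<and> (\<forall>x\<in>D. \<forall>s\<in>{0..1}. c + s *\<^sub>R (x - c) \<in> D)"

subsection \<open>Matrices\<close>

text \<open>Only applied to matrices that are symmetric, so symmetry is not part of the predicate.\<close>

definition strictly_negative_definite :: "real^'n^'n \<Rightarrow> bool" where
  "strictly_negative_definite A \<longleftrightarrow> (\<forall>v. v \<noteq> 0 \<longrightarrow> v \<bullet> (A *v v) < 0)"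

definition hermitian_transpose :: "complex^'n^'m \<Rightarrow> complex^'m^'n" where
  "hermitian_transpose X = (\<chi> i j. cnj (X $ j $ i))"

text \<open>Eigenvalues with zero real part are excluded wherever this is used.\<close>

definition sign_matrix :: "('n \<Rightarrow> complex) \<Rightarrow> complex^'n^'n" where
  "sign_matrix l =
     (\<chi> i j. if i \<noteq> j then 0 else if Re (l i) < 0 then 1 else if Re (l i) > 0 then - 1 else 0)"

definition Y_matrix :: "complex^'n^'n \<Rightarrow> ('n \<Rightarrow> complex) \<Rightarrow> real^'n^'n" where
  "Y_matrix X l =
     (\<chi> i j. Re ((matrix_inv (hermitian_transpose X) ** sign_matrix l ** matrix_inv X) $ i $ j))"

end

theory Submission
  imports Defs
begin

text \<open>
  Write \<open>w = x - x\<^sup>*\<close>. The orbital derivative of \<open>L\<close> at \<open>x\<close> is \<open>g 1\<close> for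
  \<open>g s = f (x\<^sup>* + s w) \<bullet> Y w + w \<bullet> Y (f (x\<^sup>* + s w))\<close>. Here \<open>g 0 = 0\<close> and
  \<open>g' s = w \<bullet> A (x\<^sup>* + s w) w\<close>, so the mean value theorem along the segment from \<open>x\<^sup>*\<close> to \<open>x\<close>
  makes the orbital derivative negative unless \<open>x = x\<^sup>*\<close>. That the trajectory of \<open>x\<^sup>*\<close> is
  constant needs only \<open>norm (f x) \<le> B * norm (x - x\<^sup>*)\<close> near \<open>x\<^sup>*\<close>, by a Gronwall argument.
\<close>

lemma inner_transpose_mult:
  fixes M :: "real^'n^'m"
  shows "x \<bullet> (transpose M *v y) = (M *v x) \<bullet> y"
  by (metis dot_lmul_matrix inner_commute vector_transpose_matrix)

lemma has_derivative_quadratic_form: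
  fixes Y :: "real^'n^'n"
  shows "((\<lambda>x. (x - c) \<bullet> (Y *v (x - c))) has_derivative
          (\<lambda>h. h \<bullet> (Y *v (x - c)) + (x - c) \<bullet> (Y *v h))) (at x)"
proof -
  have *: "((\<lambda>x. x - c) has_derivative (\<lambda>h. h)) (at x)"
    by (auto intro!: derivative_eq_intros)
  have "((\<lambda>x. Y *v (x - c)) has_derivative (\<lambda>h. Y *v h)) (at x)"
    by (rule bounded_linear.has_derivative[OF matrix_vector_mul_bounded_linear *])
  from has_derivative_inner[OF * this] show ?thesis
    by (simp add: add.commute)
qed

lemma C_1_quadratic_form:
  fixes Y :: "real^'n^'n"
  shows "C_k 1 (\<lambda>x. (x - c) \<bullet> (Y *v (x - c)))"
proof -
  have eq: "frechet_derivative (\<lambda>x. (x - c) \<bullet> (Y *v (x - c))) (at x) =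
        (\<lambda>h. h \<bullet> (Y *v (x - c)) + (x - c) \<bullet> (Y *v h))" for x
    using frechet_derivative_at[OF has_derivative_quadratic_form[of c Y x]] by simp
  have "continuous_on UNIV (\<lambda>x. v \<bullet> (Y *v (x - c)) + (x - c) \<bullet> (Y *v v))" for v
    by (intro continuous_intros
        continuous_on_compose2[OF linear_continuous_on[OF matrix_vector_mul_bounded_linear]]) auto
  then show ?thesis
    using has_derivative_quadratic_form unfolding One_nat_def C_k.simps eq differentiable_def
    by blast
qed

lemma quadratic_form_derivative_along_curve:
  fixes Y :: "real^'n^'n"
  assumes "(u has_vector_derivative u') (at t)"
  shows "((\<lambda>t. (u t - c) \<bullet> (Y *v (u t - c))) has_real_derivative
          (u' \<bullet> (Y *v (u t - c)) + (u t - c) \<bullet> (Y *v u'))) (at t)"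
proof -
  have "((\<lambda>t. (u t - c) \<bullet> (Y *v (u t - c))) has_derivative
      (\<lambda>h. (h *\<^sub>R u') \<bullet> (Y *v (u t - c)) + (u t - c) \<bullet> (Y *v (h *\<^sub>R u')))) (at t)"
    using has_derivative_compose[OF assms[unfolded has_vector_derivative_def]
        has_derivative_quadratic_form] .
  then show ?thesis
    unfolding has_field_derivative_def
    by (rule has_derivative_eq_rhs) (simp add: matrix_vector_mult_scaleR algebra_simps fun_eq_iff)
qed

text \<open>Definiteness of the Jacobian expression controls how \<open>f\<close> changes along a
  segment. Since \<open>f c = 0\<close>, the change from \<open>c\<close> to \<open>x\<close> is
  \<open>f x\<close> itself, and star-shapedness keeps the whole segment in
  \<open>D\<close>.\<close>

lemma orbital_derivative_negative:
  fixes f :: "real^'n \<Rightarrow> real^'n" and Y :: "real^'n^'n"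
  assumes diff: "\<And>z. f differentiable (at z)"
    and "f c = 0" and star: "star_shaped c D"
    and neg: "\<And>z. z \<in> D \<Longrightarrow>
      strictly_negative_definite (transpose (jacobian f (at z)) ** Y + Y ** jacobian f (at z))"
    and "x \<in> D" "x \<noteq> c"
  shows "f x \<bullet> (Y *v (x - c)) + (x - c) \<bullet> (Y *v f x) < 0"
proof -
  define w where "w = x - c"
  \<comment> \<open>Only the argument of \<open>f\<close> moves with \<open>s\<close>; the other
    factors stay at the full displacement \<open>w\<close>. So \<open>g\<close> is linear in
    \<open>f\<close>, and one differentiation produces the Jacobian with \<open>w\<close> on both
    sides.\<close>
  define g where "g s = f (c + s *\<^sub>R w) \<bullet> (Y *v w) + w \<bullet> (Y *v f (c + s *\<^sub>R w))" for s :: real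
  define J where "J s = jacobian f (at (c + s *\<^sub>R w))" for s :: real
  have deriv: "(g has_real_derivative
      (J s *v w) \<bullet> (Y *v w) + w \<bullet> (Y *v (J s *v w))) (at s)" for s
  proof -
    have "(f has_derivative (\<lambda>h. J s *v h)) (at (c + s *\<^sub>R w))"
      unfolding J_def using diff jacobian_works by blast
    moreover have "((\<lambda>s. c + s *\<^sub>R w) has_derivative (\<lambda>h. h *\<^sub>R w)) (at s)"
      by (auto intro!: derivative_eq_intros)
    ultimately have F: "((\<lambda>s. f (c + s *\<^sub>R w)) has_derivative (\<lambda>h. J s *v (h *\<^sub>R w))) (at s)"
      by (rule has_derivative_compose[rotated])
    have YF: "((\<lambda>s. Y *v f (c + s *\<^sub>R w)) has_derivative (\<lambda>h. Y *v (J s *v (h *\<^sub>R w)))) (at s)"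
      by (rule bounded_linear.has_derivative[OF matrix_vector_mul_bounded_linear F])
    have "(g has_derivative (\<lambda>h. (J s *v (h *\<^sub>R w)) \<bullet> (Y *v w) + w \<bullet> (Y *v (J s *v (h *\<^sub>R w))))) (at s)"
      unfolding g_def
      by (intro has_derivative_add has_derivative_inner_left[OF F] has_derivative_inner_right[OF YF])
    then show ?thesis
      unfolding has_field_derivative_def
      by (rule has_derivative_eq_rhs) (simp add: matrix_vector_mult_scaleR algebra_simps fun_eq_iff)
  qed
  \<comment> \<open>\<open>g\<close> is scalar-valued, so the mean value theorem gives an equality
    at a single intermediate \<open>s\<close>, which it would not for the vector-valued
    \<open>f\<close>.\<close>
  obtain s where s: "0 < s" "s < 1"
    and "g 1 - g 0 = (1 - 0) * ((J s *v w) \<bullet> (Y *v w) + w \<bullet> (Y *v (J s *v w)))"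
    using MVT2[OF zero_less_one, of g "\<lambda>s. (J s *v w) \<bullet> (Y *v w) + w \<bullet> (Y *v (J s *v w))"] deriv
    by blast
  then have g1: "g 1 = (J s *v w) \<bullet> (Y *v w) + w \<bullet> (Y *v (J s *v w))"
    by (simp add: g_def \<open>f c = 0\<close>)
  have "c + s *\<^sub>R w \<in> D"
    using star \<open>x \<in> D\<close> s unfolding star_shaped_def w_def by auto
  from neg[OF this] have "w \<bullet> ((transpose (J s) ** Y + Y ** J s) *v w) < 0"
    unfolding strictly_negative_definite_def J_def using \<open>x \<noteq> c\<close> by (simp add: w_def)
  also have "w \<bullet> ((transpose (J s) ** Y + Y ** J s) *v w) = g 1"
    by (simp add: g1 matrix_vector_mult_add_rdistrib inner_add_right inner_transpose_mult
        del: transpose_matrix_vector flip: matrix_vector_mul_assoc)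
  finally show ?thesis by (simp add: g_def w_def)
qed

text \<open>The definition of the derivative with error factor \<open>1\<close> leaves at most
  \<open>norm (x - c)\<close> beyond the linear part, so \<open>B = onorm f' + 1\<close>
  works.\<close>

lemma differentiable_imp_linear_bound:
  fixes f :: "'a::real_normed_vector \<Rightarrow> 'b::real_normed_vector"
  assumes "f differentiable (at c)" "f c = 0"
  obtains B d where "0 < d" "\<And>x. dist x c < d \<Longrightarrow> norm (f x) \<le> B * norm (x - c)"
proof -
  obtain f' where f': "(f has_derivative f') (at c)"
    using assms(1) by (auto simp: differentiable_def)
  then have bl: "bounded_linear f'" by (rule has_derivative_bounded_linear)
  obtain d where "0 < d"
    and d: "\<And>x. norm (x - c) < d \<Longrightarrow> norm (f x - f c - f' (x - c)) \<le> 1 * norm (x - c)"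
    using f' unfolding has_derivative_at_alt by (metis zero_less_one)
  have "norm (f x) \<le> (onorm f' + 1) * norm (x - c)" if "dist x c < d" for x
  proof -
    have "norm (f x) \<le> norm (f x - f c - f' (x - c)) + norm (f' (x - c))"
      using norm_triangle_ineq[of "f x - f' (x - c)" "f' (x - c)"] by (simp add: \<open>f c = 0\<close>)
    moreover have "norm (f' (x - c)) \<le> onorm f' * norm (x - c)" by (rule onorm[OF bl])
    ultimately show ?thesis using d[of x] that by (simp add: dist_norm algebra_simps)
  qed
  with \<open>0 < d\<close> that show ?thesis by blast
qed

text \<open>Gronwall in differential form: the squared norm grows at rate at most
  \<open>2 * B\<close>, so the weight \<open>exp (- (2 * B * t))\<close> makes it nonincreasing, and
  it starts at zero.\<close>

lemma linear_bound_imp_zero: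
  fixes u :: "real \<Rightarrow> 'a::real_inner"
  assumes "a \<le> b" "u a = 0"
    and der: "\<And>t. a \<le> t \<Longrightarrow> t \<le> b \<Longrightarrow> (u has_vector_derivative u' t) (at t)"
    and bnd: "\<And>t. a \<le> t \<Longrightarrow> t \<le> b \<Longrightarrow> norm (u' t) \<le> B * norm (u t)"
  shows "u b = 0"
proof -
  define h where "h t = (u t \<bullet> u t) * exp (- (2 * B * t))" for t
  have "\<exists>y. (h has_real_derivative y) (at t) \<and> y \<le> 0" if t: "a \<le> t" "t \<le> b" for t
  proof (intro exI conjI)
    have "((\<lambda>t. u t \<bullet> u t) has_derivative (\<lambda>x. u t \<bullet> (x *\<^sub>R u' t) + (x *\<^sub>R u' t) \<bullet> u t)) (at t)"
      using der[OF t] unfolding has_vector_derivative_def by (intro has_derivative_inner)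
    then have "((\<lambda>t. u t \<bullet> u t) has_real_derivative 2 * (u t \<bullet> u' t)) (at t)"
      unfolding has_field_derivative_def
      by (rule has_derivative_eq_rhs) (simp add: inner_commute algebra_simps fun_eq_iff)
    then show "(h has_real_derivative
        (2 * (u t \<bullet> u' t) - 2 * B * (u t \<bullet> u t)) * exp (- (2 * B * t))) (at t)"
      unfolding h_def by (auto intro!: derivative_eq_intros simp: algebra_simps)
    have "u t \<bullet> u' t \<le> norm (u t) * norm (u' t)" by (rule norm_cauchy_schwarz)
    also have "\<dots> \<le> norm (u t) * (B * norm (u t))" by (intro mult_left_mono bnd t) simp
    also have "\<dots> = B * (u t \<bullet> u t)" by (simp add: dot_square_norm power2_eq_square)
    finally show "(2 * (u t \<bullet> u' t) - 2 * B * (u t \<bullet> u t)) * exp (- (2 * B * t)) \<le> 0"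
      by (intro mult_nonpos_nonneg) auto
  qed
  then have "h b \<le> h a"
    using DERIV_nonpos_imp_nonincreasing[OF \<open>a \<le> b\<close>] by blast
  then have "u b \<bullet> u b \<le> 0"
    by (simp add: h_def \<open>u a = 0\<close> mult_le_0_iff)
  then show ?thesis by (metis inner_eq_zero_iff inner_ge_zero order_antisym)
qed

text \<open>Uniqueness at an equilibrium: the set of times at which \<open>u\<close> equals
  \<open>c\<close> is closed by continuity and open by the Gronwall bound, hence all of the
  connected real line.\<close>

lemma equilibrium_solution_constant:
  fixes f :: "'a::real_inner \<Rightarrow> 'a"
  assumes "f differentiable (at c)" "f c = 0" "u 0 = c"
    and der: "\<And>t. (u has_vector_derivative f (u t)) (at t)"
  shows "u t = c"
proof -
  obtain B d where "0 < d" and B: "\<And>x. dist x c < d \<Longrightarrow> norm (f x) \<le> B * norm (x - c)"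
    using differentiable_imp_linear_bound[OF assms(1,2)] by blast
  have cont: "continuous_on UNIV u"
    using der by (intro continuous_at_imp_continuous_on)
      (auto intro: has_vector_derivative_continuous)
  define S where "S = {t. u t = c}"
  have "closed S"
    unfolding S_def using closed_Collect_eq[OF cont continuous_on_const] .
  moreover have "open S"
    unfolding open_dist
  proof
    fix t0 assume "t0 \<in> S"
    then have u0: "u t0 = c" by (simp add: S_def)
    \<comment> \<open>Within \<open>e\<close> of \<open>t0\<close> the trajectory stays in the ball
      where the linear bound \<open>B\<close> holds.\<close>
    obtain e where "0 < e" and e: "\<And>t. dist t t0 < e \<Longrightarrow> dist (u t) c < d"
      using cont \<open>0 < d\<close> u0 unfolding continuous_on_iff by (metis UNIV_I)
    have "u t = c" if t: "dist t t0 < e" for t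
    proof (cases "t0 \<le> t")
      case True
      have "u t - c = 0"
      proof (rule linear_bound_imp_zero[where u = "\<lambda>s. u s - c" and a = t0 and B = B])
        show "((\<lambda>s. u s - c) has_vector_derivative f (u s)) (at s)" for s
          using has_vector_derivative_diff[OF der has_vector_derivative_const] by simp
        show "norm (f (u s)) \<le> B * norm (u s - c)" if "t0 \<le> s" "s \<le> t" for s
          using that t by (intro B e) (auto simp: dist_real_def)
      qed (use True u0 in auto)
      then show ?thesis by simp
    next
      case False
      \<comment> \<open>Times before \<open>t0\<close> are reached by reversing time: the Gronwall
        lemma runs forward from \<open>- t0\<close> to \<open>- t\<close>. The double negation makes
        the goal match its conclusion.\<close>
      have "u (- (- t)) - c = 0"
      proof (rule linear_bound_imp_zero[where u = "\<lambda>s. u (- s) - c" and a = "- t0" and B = B])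
        show "((\<lambda>s. u (- s) - c) has_vector_derivative - f (u (- s))) (at s)" for s
        proof -
          have "((\<lambda>s. u (- s)) has_vector_derivative (- 1) *\<^sub>R f (u (- s))) (at s)"
            using vector_diff_chain_at[of uminus "- 1" s u "f (u (- s))"] der[of "- s"]
            using has_vector_derivative_minus[OF has_vector_derivative_id]
            by (simp add: o_def)
          then show ?thesis
            using has_vector_derivative_diff[OF _ has_vector_derivative_const, of _ _ _ c] by fastforce
        qed
        show "norm (- f (u (- s))) \<le> B * norm (u (- s) - c)" if "- t0 \<le> s" "s \<le> - t" for s
          unfolding norm_minus_cancel using that t by (intro B e) (auto simp: dist_real_def)
      qed (use False u0 in auto)
      then show ?thesis by simp
    qed
    then show "\<exists>e>0. \<forall>t. dist t t0 < e \<longrightarrow> t \<in> S"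
      using \<open>0 < e\<close> by (auto simp: S_def)
  qed
  ultimately have "S = UNIV"
    using clopen[of S] \<open>u 0 = c\<close> by (auto simp: S_def)
  then show ?thesis by (auto simp: S_def)
qed

theorem theorem2p1:
  fixes f :: "real^'n \<Rightarrow> real^'n"
    and T :: "real^'n \<Rightarrow> real set"
    and \<phi> :: "real \<Rightarrow> real^'n \<Rightarrow> real^'n"
    and X :: "complex^'n^'n"
    and l :: "'n \<Rightarrow> complex"
    and Y :: "real^'n^'n"
    and A :: "real^'n \<Rightarrow> real^'n^'n"
    and L :: "real^'n \<Rightarrow> real"
    and xstar :: "real^'n"
    and D\<^sub>L :: "(real^'n) set"
  assumes "smooth f"
    and "is_flow f T \<phi>"
    and "invertible X"
    and "\<And>k. Re (l k) \<noteq> 0"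
    and "Y = Y_matrix X l"
    and "equilibrium f xstar"
    and "compact D\<^sub>L"
    and "star_shaped xstar D\<^sub>L"
    and "\<And>z. A z = transpose (jacobian f (at z)) ** Y + Y ** jacobian f (at z)"
    and "\<And>x. L x = (x - xstar) \<bullet> (Y *v (x - xstar))"
    and "\<And>z. z \<in> D\<^sub>L \<Longrightarrow> strictly_negative_definite (A z)"
  shows "lyapunov_function_on f T \<phi> D\<^sub>L L \<and>
         (\<forall>x\<in>D\<^sub>L. equilibrium f x \<longleftrightarrow> x = xstar)"
proof -
  have diff: "f differentiable (at z)" for z
    using \<open>smooth f\<close> unfolding smooth_def by (metis C_k.simps(2))
  have fx: "f xstar = 0" using assms(6) by (simp add: equilibrium_def)
  have ivp: "solves_ivp f x (T x) (\<lambda>t. \<phi> t x)"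
    and maximal: "\<And>J u. solves_ivp f x J u \<Longrightarrow> J \<subseteq> T x" for x
    using assms(2) unfolding is_flow_def by blast+
  have L_eq: "L = (\<lambda>x. (x - xstar) \<bullet> (Y *v (x - xstar)))"
    using assms(10) by auto
  define V where "V x = f x \<bullet> (Y *v (x - xstar)) + (x - xstar) \<bullet> (Y *v f x)" for x
  have neg: "V x < 0" if "x \<in> D\<^sub>L" "x \<noteq> xstar" for x
    unfolding V_def
    by (rule orbital_derivative_negative[OF diff fx assms(8) _ that])
      (use assms(9,11) in auto)
  have V0: "V xstar = 0" by (simp add: V_def fx)
  have dL: "((\<lambda>t. L (\<phi> t x)) has_real_derivative V x) (at 0)" for x
    using quadratic_form_derivative_along_curve[of "\<lambda>t. \<phi> t x" "f x" 0 xstar Y] ivp[of x]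
    unfolding L_eq V_def solves_ivp_def by auto
  \<comment> \<open>At an equilibrium \<open>V\<close> vanishes, which \<open>neg\<close> allows
    only at \<open>xstar\<close>.\<close>
  have unique: "equilibrium f x \<longleftrightarrow> x = xstar" if "x \<in> D\<^sub>L" for x
    using neg[OF that] fx by (cases "x = xstar") (auto simp: V_def equilibrium_def)
  \<comment> \<open>The constant curve is a global solution, so maximality makes
    \<open>T xstar\<close> the whole line. That \<open>\<phi>\<close> itself is this curve is a
    separate matter, because \<open>is_flow\<close> does not state uniqueness of solutions.\<close>
  have "solves_ivp f xstar UNIV (\<lambda>_. xstar)"
    by (auto simp: solves_ivp_def fx)
  then have T: "T xstar = UNIV" using maximal by blast
  have const: "\<phi> t xstar = xstar" for t
    by (rule equilibrium_solution_constant[OF diff fx])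
      (use ivp[of xstar] T in \<open>auto simp: solves_ivp_def\<close>)
  have "xstar \<in> D\<^sub>L" using assms(8) by (simp add: star_shaped_def)
  have "lyapunov_function_on f T \<phi> D\<^sub>L L"
    unfolding lyapunov_function_on_def
  proof (intro conjI ballI impI)
    show "C_k 1 L" unfolding L_eq by (rule C_1_quadratic_form)
  next
    fix x assume x: "x \<in> D\<^sub>L"
    then have "V x \<le> 0" using neg[of x] V0 by fastforce
    with dL show "\<exists>d\<le>0. ((\<lambda>t. L (\<phi> t x)) has_real_derivative d) (at 0)" by blast
  next
    fix x assume x: "x \<in> D\<^sub>L" and "((\<lambda>t. L (\<phi> t x)) has_real_derivative 0) (at 0)"
    \<comment> \<open>A zero orbital derivative forces \<open>x = xstar\<close>, so the required
      rest point is \<open>xstar\<close> itself.\<close>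
    then have "V x = 0" using dL DERIV_unique by blast
    with neg[OF x] have "x = xstar" by fastforce
    then show "\<exists>xbar\<in>D\<^sub>L. equilibrium f xbar \<and> (\<forall>t. t \<in> T x \<and> \<phi> t x = xbar)"
      using \<open>xstar \<in> D\<^sub>L\<close> assms(6) T const by auto
  qed
  with unique show ?thesis by blast
qed

end
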